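(* Let $K$ be a field of characteristic zero, let $r,s\in K$, and set $g_{r,s}(x)=\frac{1-(r-2)x+x^2}{1-sx-x^2}\in K[[x]]$. Let $\sum_{n\ge0}\mu_n z^n$ be the central transform of $g_{r,s}$, let $h_n=\det(\mu_{i+j})_{0\le i,j\le n}$ for $n\ge 0$, and let $H_{g_{r,s}}(x)=\sum_{n\ge0}h_nx^n\in K[[x]]$. Then $$H_{g_{r,s}}(x)=\frac{1-s(r+s-2)x}{1+2s(2-r)x+4s^2x^2}.$$ Equivalently, $h_0=1$, $h_1=s(r-s-2)$, and $h_n=2s(r-2)h_{n-1}-4s^2h_{n-2}$ for all $n\ge2$.
   Context: All power series are formal. For a commutative $\mathbb{Q}$-algebra $R$ and $g(x)\in R[[x]]$ with $g(0)=1$, the central transform of $g$ is the power series $\mathcal{C}(g)(z)=\sum_{n\ge0}\mu_n z^n\in R[[z]]$ with coefficients $$\mu_n=[x^{2n}]\left(\frac{1}{(1-x)\,g\left(\frac{x}{1-x}\right)}\left(\frac{x}{1-x}\right)^n\right),$$ where $[x^{m}]F(x)$ denotes the coefficient of $x^m$ in $F(x)$. *)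

theory Defs
  imports
    "HOL-Computational_Algebra.Formal_Power_Series"
    "Jordan_Normal_Form.Determinant"
begin

text \<open>
  All division below is division of formal power series over a field. Every denominator
  that occurs has a nonzero constant coefficient (for the central transform this is the
  hypothesis \<open>g(0) = 1\<close>), so each quotient is the product with the multiplicative inverse.
\<close>

text \<open>
  The composition \<open>g oo (X / (1 - X))\<close> is the substitution \<open>g(x / (1 - x))\<close>; the inner series
  has constant coefficient \<open>0\<close>. Only series with \<open>g(0) = 1\<close> are meaningful arguments.
\<close>

definition central_transform :: "'a::field_char_0 fps \<Rightarrow> 'a fps" where
  "central_transform g = Abs_fps (\<lambda>n. fps_nth
     (1 / ((1 - fps_X) * (g oo (fps_X / (1 - fps_X)))) * (fps_X / (1 - fps_X)) ^ n) (2 * n))"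

definition hankel_det :: "(nat \<Rightarrow> 'a::comm_ring_1) \<Rightarrow> nat \<Rightarrow> 'a" where
  "hankel_det \<mu> n = det (mat (n + 1) (n + 1) (\<lambda>(i, j). \<mu> (i + j)))"

definition hankel_gf :: "'a::field_char_0 fps \<Rightarrow> 'a fps" where
  "hankel_gf g = Abs_fps (hankel_det (fps_nth (central_transform g)))"

definition g_rs :: "'a::field_char_0 \<Rightarrow> 'a \<Rightarrow> 'a fps" where
  "g_rs r s = (1 - fps_const (r - 2) * fps_X + fps_X ^ 2) / (1 - fps_const s * fps_X - fps_X ^ 2)"

end

theory Submission
  imports Defs
begin

text \<open>
  Write \<open>y = x / (1 - x)\<close>. For \<open>g = g_rs r s\<close> one finds
  \<open>1 / ((1 - x) g(y)) = (1 - 2x - s x (1 - x)) / ((1 - x) (1 - r x (1 - x)))\<close>.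
  Since \<open>x (1 - x)\<close> is exactly the quantity by which two consecutive coefficient extractions
  differ, multiplying by \<open>1 - r x (1 - x)\<close> turns into \<open>\<mu>\<^sub>n\<^sub>+\<^sub>1 - r \<mu>\<^sub>n\<close>, and what remains
  are coefficients of powers of \<open>1 / (1 - x)\<close>:
  \<open>\<mu>\<^sub>0 = 1\<close> and \<open>\<mu>\<^sub>n\<^sub>+\<^sub>1 = r \<mu>\<^sub>n - s c\<^sub>n\<close> with the central binomial coefficients
  \<open>c\<^sub>n = (2n choose n)\<close> (\<open>central_transform_g_rs_recurrence\<close>).

  The sequence \<open>c\<^sub>n\<close> is the moment sequence of the arcsine law on \<open>[0, 4]\<close>: \<open>c\<^sub>n\<close> is the
  constant term of \<open>(2 + w + 1/w) ^ n\<close>. Its monic orthogonal polynomials \<open>p\<^sub>k\<close> are therefore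
  Chebyshev polynomials in \<open>x - 2\<close>. If \<open>L\<close> and \<open>M\<close> are the linear functionals on polynomials
  with moments \<open>\<mu>\<close> and \<open>c\<close>, the recurrence for \<open>\<mu>\<close> says \<open>L ((x - r) q) = - s M q\<close>. This suggests
  the monic polynomials \<open>1, (x - r) p\<^sub>0, (x - r) p\<^sub>1, \<dots>\<close>: in them, the Gram matrix of \<open>L\<close> has
  the entries \<open>1\<close>, \<open>- s M (p\<^sub>j)\<close> and \<open>- s M ((x - r) p\<^sub>i p\<^sub>j)\<close>, and by orthogonality
  and the three-term recurrence of the \<open>p\<^sub>k\<close> it is tridiagonal with constant entries from the
  third row on. A monic change of basis does not affect the Hankel determinant
  (\<open>hankel_det_eq_det_monic\<close>), and the determinant of a tridiagonal matrix satisfies a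
  second-order recurrence (\<open>det_tridiagonal_rec\<close>), which is the asserted one
  (\<open>hankel_det_rec\<close>). The closed form of the generating function is this recurrence
  together with its two initial values.
\<close>

section \<open>Moment functionals and Hankel determinants\<close>

definition moment_functional :: "(nat \<Rightarrow> 'a::comm_ring_1) \<Rightarrow> 'a poly \<Rightarrow> 'a" where
  "moment_functional b p = (\<Sum>k\<le>degree p. coeff p k * b k)"

lemma moment_functional_upto:
  assumes "degree p \<le> N"
  shows "moment_functional b p = (\<Sum>k\<le>N. coeff p k * b k)"
  unfolding moment_functional_def
  by (rule sum.mono_neutral_left) (use assms in \<open>auto simp: coeff_eq_0\<close>)

lemma moment_functional_0 [simp]: "moment_functional b 0 = 0"
  by (simp add: moment_functional_def)

lemma moment_functional_add:
  "moment_functional b (p + q) = moment_functional b p + moment_functional b q"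
proof -
  define N where "N = max (degree p) (degree q)"
  have "degree (p + q) \<le> N" "degree p \<le> N" "degree q \<le> N"
    unfolding N_def by (auto intro: degree_add_le_max)
  then show ?thesis
    by (simp add: moment_functional_upto sum.distrib algebra_simps)
qed

lemma moment_functional_smult:
  "moment_functional b (smult c p) = c * moment_functional b p"
  using moment_functional_upto[of "smult c p" "degree p" b]
  by (simp add: moment_functional_def sum_distrib_left mult.assoc degree_smult_le)

lemma moment_functional_diff:
  "moment_functional b (p - q) = moment_functional b p - moment_functional b q"
  using moment_functional_add[of b "p - q" q] by simp

lemma moment_functional_sum:
  "moment_functional b (\<Sum>i\<in>A. f i) = (\<Sum>i\<in>A. moment_functional b (f i))"
  by (induction A rule: infinite_finite_induct) (auto simp: moment_functional_add)

lemma moment_functional_monom: "moment_functional b (monom c n) = c * b n"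
proof -
  have "moment_functional b (monom c n) = (\<Sum>k\<le>n. if k = n then c * b n else 0)"
    unfolding moment_functional_upto[OF degree_monom_le] by (rule sum.cong) auto
  then show ?thesis
    by simp
qed

lemma moment_functional_mult:
  assumes "degree p \<le> N"
  shows "moment_functional b (p * q) =
           (\<Sum>n\<le>N. coeff p n * moment_functional b (monom 1 n * q))"
proof -
  have "p * q = (\<Sum>n\<le>N. smult (coeff p n) (monom 1 n * q))"
    by (subst poly_as_sum_of_monoms'[OF assms, symmetric])
       (simp add: sum_distrib_right smult_monom flip: mult_smult_left)
  then show ?thesis
    by (simp add: moment_functional_sum moment_functional_smult)
qed

text \<open>
  The coefficient matrix of a monic family is lower unitriangular, so passing from the monomials
  to the family multiplies the Hankel matrix on both sides by a matrix of determinant \<open>1\<close>.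
\<close>

lemma hankel_det_eq_det_monic:
  fixes b :: "nat \<Rightarrow> 'a::comm_ring_1"
  assumes deg: "\<And>i. degree (P i) \<le> i" and monic: "\<And>i. coeff (P i) i = 1"
  shows "hankel_det b n =
           det (mat (n + 1) (n + 1) (\<lambda>(i, j). moment_functional b (P i * P j)))"
proof -
  define H where "H = mat (n + 1) (n + 1) (\<lambda>(i, j). b (i + j))"
  define C where "C = mat (n + 1) (n + 1) (\<lambda>(i, j). coeff (P i) j)"
  have HC: "H \<in> carrier_mat (n + 1) (n + 1)" "C \<in> carrier_mat (n + 1) (n + 1)"
    by (auto simp: H_def C_def)
  have "det C = prod_list (diag_mat C)"
  proof (rule det_lower_triangular[OF _ HC(2)])
    fix i j assume "i < j" "j < n + 1"
    then show "C $$ (i, j) = 0"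
      using deg[of i] by (auto simp: C_def intro!: coeff_eq_0)
  qed
  also have "\<dots> = 1"
    by (simp add: prod_list_diag_prod C_def monic)
  finally have detC: "det C = 1" .
  have "mat (n + 1) (n + 1) (\<lambda>(i, j). moment_functional b (P i * P j)) = C * H * C\<^sup>T"
  proof (rule eq_matI)
    fix i j assume "i < dim_row (C * H * C\<^sup>T)" "j < dim_col (C * H * C\<^sup>T)"
    then have ij: "i \<le> n" "j \<le> n"
      using HC by auto
    have monom_eq: "moment_functional b (monom 1 k * P j) = (\<Sum>l\<le>n. coeff (P j) l * b (k + l))" for k
      using moment_functional_mult[of "P j" n b "monom 1 k"] deg[of j] ij
      by (simp add: mult.commute mult_monom moment_functional_monom add.commute)
    have "(C * H * C\<^sup>T) $$ (i, j) =
            (\<Sum>l<n+1. (\<Sum>k<n+1. coeff (P i) k * b (k + l)) * coeff (P j) l)"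
      using ij by (simp add: C_def H_def scalar_prod_def atLeast0LessThan)
    also have "\<dots> = (\<Sum>k\<le>n. coeff (P i) k * (\<Sum>l\<le>n. coeff (P j) l * b (k + l)))"
      unfolding sum_distrib_left sum_distrib_right
      by (subst sum.swap) (simp add: mult_ac lessThan_Suc_atMost)
    also have "\<dots> = moment_functional b (P i * P j)"
      using deg[of i] ij by (simp add: moment_functional_mult[of "P i" n] monom_eq)
    finally show "mat (n + 1) (n + 1) (\<lambda>(i, j). moment_functional b (P i * P j)) $$ (i, j)
                    = (C * H * C\<^sup>T) $$ (i, j)"
      using ij by simp
  qed (auto simp: C_def H_def)
  also have "det (C * H * C\<^sup>T) = det C * det H * det C"
    using HC by (simp add: det_mult[of _ "n + 1"] det_transpose)
  finally show ?thesis
    by (simp add: detC H_def hankel_det_def)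
qed

text \<open>
  Expand along the last row. Its last entry has the leading block as its minor; the minor of the
  other nonzero entry has a single nonzero entry in its last column, along which one expands again.
\<close>

lemma det_tridiagonal_rec:
  fixes E :: "nat \<Rightarrow> nat \<Rightarrow> 'a::comm_ring_1"
  assumes zero: "\<And>i j. i + 1 < j \<or> j + 1 < i \<Longrightarrow> E i j = 0"
  defines "D \<equiv> \<lambda>m. det (mat m m (\<lambda>(i, j). E i j))"
  shows "D (n + 2) = E (n + 1) (n + 1) * D (n + 1) - E n (n + 1) * E (n + 1) n * D n"
proof -
  define A where "A = mat (n + 2) (n + 2) (\<lambda>(i, j). E i j)"
  define B where "B = mat_delete A (n + 1) n"
  have A: "A \<in> carrier_mat (n + 2) (n + 2)" and B: "B \<in> carrier_mat (n + 1) (n + 1)"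
    by (auto simp: A_def B_def mat_delete_def)
  have "det B = (\<Sum>i<n+1. B $$ (i, n) * cofactor B i n)"
    by (rule laplace_expansion_column[OF B]) simp
  also have "\<dots> = B $$ (n, n) * cofactor B n n"
    using zero by (auto simp: B_def A_def mat_delete_def intro!: sum.neutral)
  also have "B $$ (n, n) = E n (n + 1)"
    by (simp add: B_def A_def mat_delete_def)
  also have "cofactor B n n = D n"
    by (simp add: cofactor_def D_def B_def A_def mat_delete_def flip: mult_2)
       (rule arg_cong[of _ _ det], rule eq_matI, auto)
  finally have detB: "det B = E n (n + 1) * D n" .
  have "D (n + 2) = (\<Sum>j<n+2. A $$ (n + 1, j) * cofactor A (n + 1) j)"
    unfolding D_def A_def[symmetric] by (rule laplace_expansion_row[OF A]) simp
  also have "\<dots> = A $$ (n + 1, n) * cofactor A (n + 1) n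
                 + A $$ (n + 1, n + 1) * cofactor A (n + 1) (n + 1)"
    using zero by (simp add: A_def)
  also have "cofactor A (n + 1) n = - det B"
    by (simp add: cofactor_def B_def flip: mult_2)
  also have "cofactor A (n + 1) (n + 1) = D (n + 1)"
    by (simp add: cofactor_def D_def A_def mat_delete_def flip: mult_2)
       (rule arg_cong[of _ _ det], rule eq_matI, auto)
  finally show ?thesis
    by (simp add: detB A_def algebra_simps)
qed

section \<open>Orthogonal polynomials for the central binomial coefficients\<close>

definition central_binom :: "nat \<Rightarrow> 'a::comm_ring_1" where
  "central_binom n = of_nat ((2 * n) choose n)"

text \<open>
  At \<open>x = 2 + w + 1/w\<close> the \<open>k\<close>-th polynomial takes the value \<open>w ^ k + w ^ (-k)\<close> for \<open>k > 0\<close>. The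
  factor \<open>2\<close> in the first step of the recurrence appears because the \<open>0\<close>-th polynomial is \<open>1\<close>
  rather than \<open>w ^ 0 + w ^ 0\<close>: this keeps the whole family monic.
\<close>

fun shifted_cheb :: "nat \<Rightarrow> 'a::comm_ring_1 poly" where
  "shifted_cheb 0 = 1"
| "shifted_cheb (Suc 0) = [:-2, 1:]"
| "shifted_cheb (Suc (Suc k)) =
     [:-2, 1:] * shifted_cheb (Suc k) - smult (if k = 0 then 2 else 1) (shifted_cheb k)"

lemma degree_shifted_cheb: "degree (shifted_cheb k :: 'a::comm_ring_1 poly) \<le> k"
proof (induction k rule: shifted_cheb.induct)
  case (3 k)
  have "degree ([:-2, 1:] * shifted_cheb (Suc k) :: 'a poly) \<le> 1 + Suc k"
    by (rule order_trans[OF degree_mult_le]) (use 3 in \<open>auto intro!: add_mono\<close>)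
  then show ?case
    using 3(2) order_trans[OF degree_smult_le 3(2)]
    by (auto intro!: degree_diff_le simp del: mult_pCons_left) 
qed auto

lemma coeff_shifted_cheb_self: "coeff (shifted_cheb k :: 'a::comm_ring_1 poly) k = 1"
proof (induction k rule: shifted_cheb.induct)
  case (3 k)
  have "coeff (shifted_cheb k :: 'a poly) (Suc (Suc k)) = 0"
       "coeff (shifted_cheb (Suc k) :: 'a poly) (Suc (Suc k)) = 0"
    using degree_shifted_cheb[of k, where ?'a = 'a] degree_shifted_cheb[of "Suc k", where ?'a = 'a]
    by (auto intro!: coeff_eq_0)
  then show ?case
    using 3 by simp
qed auto

text \<open>
  Pascal's rule applied twice, that is, multiplication of \<open>(1 + w) ^ (2 * n)\<close> by \<open>1 + 2 w + w\<^sup>2\<close>.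
\<close>

lemma central_choose_step:
  "(2 * Suc n) choose (Suc n + Suc k) =
     ((2 * n) choose (n + k)) + 2 * ((2 * n) choose (n + Suc k)) + ((2 * n) choose (n + Suc (Suc k)))"
  by (simp add: numeral_2_eq_2)

text \<open>
  The same step at the centre, where the two outer terms coincide by symmetry.
\<close>

lemma central_choose_step_0:
  "(2 * Suc n) choose (Suc n) = 2 * ((2 * n) choose n) + 2 * ((2 * n) choose (Suc n))"
proof (cases n)
  case (Suc m)
  have "(2 * n) choose m = (2 * n) choose (Suc n)"
    using Suc by (subst binomial_symmetric) auto
  then show ?thesis
    using Suc by simp
qed simp

lemma moment_monom_mult_pCons:
  "moment_functional b (monom 1 n * ([:c, 1:] * p)) =
     moment_functional b (monom 1 (Suc n) * p) + c * moment_functional b (monom 1 n * p)"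
proof -
  have "monom 1 n * ([:c, 1:] * p) = monom 1 (Suc n) * p + smult c (monom 1 n * p)"
    by (simp add: monom_Suc algebra_simps)
  then show ?thesis
    by (simp only: moment_functional_add moment_functional_smult)
qed

text \<open>
  Up to the factor, this is the coefficient of \<open>w ^ k\<close> in \<open>(2 + w + 1/w) ^ n = (1 + w) ^ (2 * n) / w ^ n\<close>.
  In particular it vanishes for \<open>n < k\<close>, which is the orthogonality used below.
\<close>

lemma moment_monom_shifted_cheb:
  "moment_functional central_binom (monom 1 n * shifted_cheb k) =
     (if k = 0 then 1 else 2) * of_nat ((2 * n) choose (n + k))"
proof (induction k arbitrary: n rule: shifted_cheb.induct)
  case 1
  show ?case by (simp add: moment_functional_monom central_binom_def)
next
  case 2
  have "moment_functional central_binom (monom 1 n * ([:-2, 1:] * 1)) =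
    (of_nat ((2 * Suc n) choose (Suc n)) - 2 * of_nat ((2 * n) choose n) :: 'a)"
    unfolding moment_monom_mult_pCons by (simp add: moment_functional_monom central_binom_def)
  then show ?case
    unfolding central_choose_step_0 by simp
next
  case (3 k)
  have "moment_functional central_binom (monom 1 n * shifted_cheb (Suc (Suc k))) =
     2 * of_nat ((2 * Suc n) choose (Suc n + Suc k))
     - 2 * (2 * of_nat ((2 * n) choose (n + Suc k)))
     - (2 * of_nat ((2 * n) choose (n + k)) :: 'a)"
    using 3 unfolding shifted_cheb.simps right_diff_distrib moment_functional_diff mult_smult_right
      moment_functional_smult moment_monom_mult_pCons
    by simp
  then show ?case
    unfolding central_choose_step by (simp add: algebra_simps)
qed

lemma moment_mult_shifted_cheb:
  assumes "degree q \<le> k"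
  shows "moment_functional central_binom (q * shifted_cheb k) = (if k = 0 then 1 else 2) * coeff q k"
proof -
  have "moment_functional central_binom (q * shifted_cheb k) =
     (\<Sum>n\<le>k. if n = k then (if k = 0 then 1 else 2) * coeff q k else 0)"
    unfolding moment_functional_mult[OF assms] moment_monom_shifted_cheb
    by (rule sum.cong) (auto simp: binomial_eq_0 simp flip: mult_2)
  then show ?thesis
    by simp
qed

lemma moment_shifted_cheb_orthogonal:
  "j < k \<Longrightarrow>
     moment_functional central_binom (shifted_cheb j * shifted_cheb k) = (0 :: 'a::comm_ring_1)"
  using degree_shifted_cheb[of j, where ?'a = 'a] by (subst moment_mult_shifted_cheb) (auto simp: coeff_eq_0)

lemma moment_shifted_cheb_square:
  "moment_functional central_binom (shifted_cheb k * shifted_cheb k) = (if k = 0 then 1 else 2)"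
  by (subst moment_mult_shifted_cheb) (auto simp: degree_shifted_cheb coeff_shifted_cheb_self)

text \<open>
  The matrix of multiplication by \<open>x - c\<close> is tridiagonal, and its diagonal is constant up to
  normalisation because every recurrence step multiplies by the same factor \<open>x - 2\<close>.
\<close>

lemma moment_linear_shifted_cheb:
  fixes c :: "'a::comm_ring_1"
  shows moment_linear_shifted_cheb_diag:
      "moment_functional central_binom ([:-c, 1:] * shifted_cheb k * shifted_cheb k)
         = (if k = 0 then 1 else 2) * (2 - c)"
    and moment_linear_shifted_cheb_off:
      "moment_functional central_binom ([:-c, 1:] * shifted_cheb k * shifted_cheb (Suc k)) = 2"
    and moment_linear_shifted_cheb_far: "k + 1 < l \<Longrightarrow>
       moment_functional central_binom ([:-c, 1:] * shifted_cheb k * shifted_cheb l) = 0"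
proof -
  let ?L = "moment_functional (central_binom :: nat \<Rightarrow> 'a)"
  have deg: "degree ([:-c, 1:] * shifted_cheb k) \<le> Suc k"
    by (rule order_trans[OF degree_mult_le]) (use degree_shifted_cheb[of k, where ?'a = 'a] in simp)
  show "?L ([:-c, 1:] * shifted_cheb k * shifted_cheb (Suc k)) = 2"
    using deg degree_shifted_cheb[of k, where ?'a = 'a]
    by (simp add: moment_mult_shifted_cheb coeff_shifted_cheb_self coeff_eq_0 del: mult_pCons_left)
       (simp add: coeff_shifted_cheb_self coeff_eq_0)
  show "?L ([:-c, 1:] * shifted_cheb k * shifted_cheb l) = 0" if "k + 1 < l"
    using deg that by (simp add: moment_mult_shifted_cheb coeff_eq_0 del: mult_pCons_left)
  show "?L ([:-c, 1:] * shifted_cheb k * shifted_cheb k) = (if k = 0 then 1 else 2) * (2 - c)"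
  proof -
    have split: "[:-c, 1:] * p = [:-2, 1:] * p + smult (2 - c) p" for p :: "'a poly"
      by (simp add: smult_diff_left)
    \<comment> \<open>Multiplication by \<open>x - 2\<close> moves to the neighbouring degrees, hence has zero diagonal.\<close>
    have lin2: "?L ([:-2, 1:] * shifted_cheb k * shifted_cheb k) = 0"
    proof (cases k)
      case 0
      then show ?thesis
        using moment_shifted_cheb_orthogonal[of 0 1, where ?'a = 'a] by simp
    next
      case (Suc m)
      have "[:-2, 1:] * shifted_cheb k =
              shifted_cheb (Suc k) + smult (if m = 0 then 2 else 1) (shifted_cheb m :: 'a poly)"
        unfolding Suc by (simp del: mult_pCons_left)
      then have "?L ([:-2, 1:] * shifted_cheb k * shifted_cheb k) =
          ?L (shifted_cheb k * shifted_cheb (Suc k))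
            + (if m = 0 then 2 else 1) * ?L (shifted_cheb m * shifted_cheb k)"
        by (simp only: distrib_right moment_functional_add moment_functional_smult mult_smult_left
            mult.commute[of "shifted_cheb (Suc k)" "shifted_cheb k"])
      then show ?thesis
        using Suc by (simp only: moment_shifted_cheb_orthogonal lessI mult_zero_right add_0_right)
    qed
    show ?thesis
      unfolding split distrib_right mult_smult_left
      by (simp add: moment_functional_add moment_functional_smult lin2[simplified mult.assoc] lin2
          moment_shifted_cheb_square del: mult_pCons_left)
  qed
qed

section \<open>Sequences with an inhomogeneous central binomial recurrence\<close>

text \<open>
  The factor \<open>x - r\<close> reduces the functional with moments \<open>\<mu>\<close> to the one with central binomial
  moments; the constant \<open>1\<close> is prepended so that all degrees occur.
\<close>

fun adapted_poly :: "'a::comm_ring_1 \<Rightarrow> nat \<Rightarrow> 'a poly" where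
  "adapted_poly r 0 = 1"
| "adapted_poly r (Suc k) = [:-r, 1:] * shifted_cheb k"

lemma degree_adapted_poly: "degree (adapted_poly r k) \<le> k"
proof (cases k)
  case (Suc m)
  then show ?thesis
    by (auto simp del: mult_pCons_left intro!: order_trans[OF degree_mult_le]
        simp: degree_shifted_cheb)
qed simp

lemma coeff_adapted_poly_self: "coeff (adapted_poly r k) k = 1"
proof (cases k)
  case (Suc m)
  have "coeff (shifted_cheb m :: 'a poly) (Suc m) = 0"
    using degree_shifted_cheb[of m, where ?'a = 'a] by (intro coeff_eq_0) simp
  then show ?thesis
    using Suc by (simp add: coeff_shifted_cheb_self)
qed simp

context
  fixes r s :: "'a::comm_ring_1" and \<mu> :: "nat \<Rightarrow> 'a"
  assumes mu_0: "\<mu> 0 = 1"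
    and mu_Suc: "\<And>n. \<mu> (Suc n) = r * \<mu> n - s * central_binom n"
begin

text \<open>
  Evaluating on monomials, this is the recurrence for \<open>\<mu>\<close>.
\<close>

lemma moment_linear_factor:
  "moment_functional \<mu> ([:-r, 1:] * q) = - s * moment_functional central_binom q"
proof -
  have "moment_functional \<mu> ([:-r, 1:] * q) = moment_functional \<mu> (q * [:-r, 1:])"
    by (simp only: mult.commute)
  also have "\<dots> = (\<Sum>n\<le>degree q. coeff q n * (\<mu> (Suc n) - r * \<mu> n))"
    using moment_monom_mult_pCons[of \<mu> _ "-r" 1]
    by (subst moment_functional_mult[OF order_refl]) (simp add: moment_functional_monom)
  also have "\<dots> = - s * moment_functional central_binom q"
    by (simp add: mu_Suc moment_functional_def sum_distrib_left mult_ac flip: sum_negf)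
  finally show ?thesis .
qed

text \<open>
  The Gram matrix \<open>E\<close> of the adapted polynomials has entry \<open>1\<close> in the corner, \<open>- s\<close> next to it,
  \<open>- s (2 - r)\<close> as second diagonal entry, and from there on \<open>- 2 s (2 - r)\<close> on the diagonal and
  \<open>- 2 s\<close> beside it. The irregular start affects only the two initial determinants.
\<close>

lemma hankel_det_rec:
  shows hankel_det_rec_0: "hankel_det \<mu> 0 = 1"
    and hankel_det_rec_1: "hankel_det \<mu> 1 = s * (r - s - 2)"
    and hankel_det_rec_Suc_Suc: "hankel_det \<mu> (m + 2) =
          2 * s * (r - 2) * hankel_det \<mu> (m + 1) - 4 * s ^ 2 * hankel_det \<mu> m"
proof -
  define E where "E = (\<lambda>i j. moment_functional \<mu> (adapted_poly r i * adapted_poly r j))"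
  have sym: "E i j = E j i" for i j
    by (simp add: E_def mult.commute)
  have E_0_Suc: "E 0 (Suc j) = (if j = 0 then - s else 0)" for j
    using moment_shifted_cheb_orthogonal[of 0 j, where ?'a = 'a]
      moment_shifted_cheb_square[of 0, where ?'a = 'a]
      moment_linear_factor[of "shifted_cheb j"]
    by (cases j) (simp_all add: E_def del: mult_pCons_left)
  have E_Suc_Suc: "E (Suc i) (Suc j) =
      - s * moment_functional central_binom ([:-r, 1:] * shifted_cheb i * shifted_cheb j)" for i j
  proof -
    have "adapted_poly r (Suc i) * adapted_poly r (Suc j)
            = [:-r, 1:] * ([:-r, 1:] * shifted_cheb i * shifted_cheb j)"
      by (simp only: adapted_poly.simps mult_ac)
    then show ?thesis
      unfolding E_def by (simp only: moment_linear_factor)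
  qed
  have E00: "E 0 0 = 1"
    using moment_functional_monom[of \<mu> 1 0] by (simp add: E_def mu_0)
  have far: "E i j = 0" if "i + 1 < j" for i j
  proof (cases i)
    case 0
    then show ?thesis
      using that E_0_Suc[of "j - 1"] by auto
  next
    case (Suc i')
    then show ?thesis
      using that E_Suc_Suc[of i' "j - 1"] moment_linear_shifted_cheb_far[of i' "j - 1" r]
      by auto
  qed
  then have zero: "E i j = 0" if "i + 1 < j \<or> j + 1 < i" for i j
    using that sym by metis
  define D where "D = (\<lambda>m. det (mat m m (\<lambda>(i, j). E i j)))"
  have h: "hankel_det \<mu> n = D (n + 1)" for n
    unfolding D_def E_def
    by (rule hankel_det_eq_det_monic[OF degree_adapted_poly coeff_adapted_poly_self])
  have D_rec: "D (n + 2) = E (n + 1) (n + 1) * D (n + 1) - E n (n + 1) ^ 2 * D n" for n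
    using det_tridiagonal_rec[of E n, OF zero] sym[of "n + 1" n]
    by (simp add: D_def power2_eq_square)
  have D0: "D 0 = 1" and D1: "D 1 = 1"
    by (simp_all add: D_def det_single E00)
  show "hankel_det \<mu> 0 = 1"
    by (simp add: h D1[simplified])
  have "E 1 1 = - s * (2 - r)"
    using E_Suc_Suc[of 0 0] moment_linear_shifted_cheb_diag[of r 0]
    by (simp del: mult_pCons_left shifted_cheb.simps)
  then have "D 2 = - s * (2 - r) - s ^ 2"
    using D_rec[of 0] E_0_Suc[of 0] D0 D1 by (simp flip: numeral_2_eq_2)
  then have "hankel_det \<mu> 1 = - s * (2 - r) - s ^ 2"
    by (simp only: h one_add_one)
  also have "\<dots> = s * (r - s - 2)"
    by (simp add: algebra_simps power2_eq_square)
  finally show "hankel_det \<mu> 1 = s * (r - s - 2)" .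
  have "E (m + 2) (m + 2) = - s * (2 * (2 - r))"
    using E_Suc_Suc[of "m + 1" "m + 1"] moment_linear_shifted_cheb_diag[of r "m + 1"]
    by (simp del: mult_pCons_left)
  then have diag: "E (m + 2) (m + 2) = 2 * s * (r - 2)"
    by (simp add: algebra_simps)
  have off: "E (m + 1) (m + 2) = - 2 * s"
    using E_Suc_Suc[of m "m + 1"] moment_linear_shifted_cheb_off[of r m]
    by (simp del: mult_pCons_left)
  show "hankel_det \<mu> (m + 2) =
          2 * s * (r - 2) * hankel_det \<mu> (m + 1) - 4 * s ^ 2 * hankel_det \<mu> m"
    using D_rec[of "m + 1"] diag off by (simp add: h power2_eq_square)
qed

end

section \<open>The central transform\<close>

lemma inverse_one_minus_X_power_nth:
  "fps_nth (inverse ((1 - fps_X) ^ Suc n) :: 'a::field_char_0 fps) k = of_nat ((n + k) choose k)"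
  using one_minus_const_fps_X_neg_power'[of "Suc n" "1 :: 'a"] by simp

text \<open>
  The factor \<open>x ^ n\<close> in the definition of the transform cancels half of the index, so
  \<open>\<mu>\<^sub>n\<close> is the coefficient of \<open>x ^ n\<close> in \<open>\<Phi> / (1 - x) ^ n\<close> with \<open>\<Phi> = 1 / ((1 - x) g(x / (1 - x)))\<close>.
  Hence \<open>\<mu>\<^sub>n\<^sub>+\<^sub>1 - r \<mu>\<^sub>n\<close> is the coefficient of \<open>x ^ (n + 1)\<close> in
  \<open>\<Phi> (1 - r x (1 - x)) / (1 - x) ^ (n + 1)\<close>, where the denominator of \<open>\<Phi>\<close> cancels. The part
  \<open>1 - 2x\<close> of the numerator contributes \<open>(2n+2 choose n+1) - 2 (2n+1 choose n) = 0\<close>, and the part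
  \<open>- s x (1 - x)\<close> contributes \<open>- s (2n choose n)\<close>.
\<close>

lemma central_transform_g_rs_recurrence:
  fixes r s :: "'a::field_char_0"
  defines "\<mu> \<equiv> fps_nth (central_transform (g_rs r s))"
  shows central_transform_g_rs_0: "\<mu> 0 = 1"
    and central_transform_g_rs_Suc: "\<mu> (Suc n) = r * \<mu> n - s * central_binom n"
proof -
  define X where "X = (fps_X :: 'a fps)"
  define Q where "Q = inverse (1 - X)"
  define Y where "Y = X / (1 - X)"
  define G where "G = g_rs r s oo Y"
  define \<Phi> where "\<Phi> = 1 / ((1 - X) * G)"
  have Q: "(1 - X) * Q = 1"
    unfolding Q_def X_def by (rule inverse_mult_eq_1') simp
  have Y: "Y = X * Q"
    unfolding Y_def Q_def by (rule fps_divide_unit) (simp add: X_def)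
  have Y0: "fps_nth Y 0 = 0"
    by (simp add: Y X_def)
  have XY: "(1 - X) * Y = X"
  proof -
    have "(1 - X) * Y = X * ((1 - X) * Q)"
      unfolding Y by (rule mult.left_commute)
    then show ?thesis
      by (simp only: Q mult_1_right)
  qed
  have den0: "fps_nth (1 - fps_const s * X - X ^ 2) 0 \<noteq> 0"
    by (simp add: X_def)
  have "g_rs r s * (1 - fps_const s * X - X ^ 2) = 1 - fps_const (r - 2) * X + X ^ 2"
    unfolding g_rs_def X_def[symmetric] fps_divide_unit[OF den0]
    using inverse_mult_eq_1[OF den0] by (simp add: mult.assoc)
  then have "(g_rs r s * (1 - fps_const s * X - X ^ 2)) oo Y
               = (1 - fps_const (r - 2) * X + X ^ 2) oo Y"
    by simp
  then have GY: "G * (1 - fps_const s * Y - Y ^ 2) = 1 - fps_const (r - 2) * Y + Y ^ 2"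
    by (simp only: fps_compose_mult_distrib[OF Y0] fps_compose_sub_distrib fps_compose_add_distrib
        fps_compose_power[OF Y0, symmetric] fps_const_compose fps_compose_1
        fps_X_fps_compose_startby0[OF Y0] X_def G_def)
  have "fps_nth G 0 = 1"
    by (simp add: G_def fps_compose_nth g_rs_def fps_divide_unit)
  then have G0: "fps_nth ((1 - X) * G) 0 \<noteq> 0"
    by (simp add: X_def)
  have Phi: "\<Phi> * ((1 - X) * G) = 1"
    unfolding \<Phi>_def fps_divide_unit[OF G0] using inverse_mult_eq_1[OF G0] by simp
  \<comment> \<open>Clearing denominators: numerator and denominator of \<open>g(Y)\<close> are multiplied by \<open>(1 - X)\<^sup>2\<close>.\<close>
  have "\<Phi> * (1 - X) * ((1 - X) ^ 2 * (1 - fps_const (r - 2) * Y + Y ^ 2))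
          = (\<Phi> * ((1 - X) * G)) * ((1 - X) ^ 2 * (1 - fps_const s * Y - Y ^ 2))"
    unfolding GY[symmetric] by (simp add: mult_ac)
  also have "(1 - X) ^ 2 * (1 - fps_const s * Y - Y ^ 2) =
      (1 - X) ^ 2 - fps_const s * (1 - X) * ((1 - X) * Y) - ((1 - X) * Y) ^ 2"
    by (simp add: algebra_simps power2_eq_square)
  also have "\<dots> = 1 - 2 * X - fps_const s * X * (1 - X)"
    unfolding XY by (simp add: algebra_simps power2_eq_square)
  also have "(1 - X) ^ 2 * (1 - fps_const (r - 2) * Y + Y ^ 2) =
      (1 - X) ^ 2 - fps_const (r - 2) * (1 - X) * ((1 - X) * Y) + ((1 - X) * Y) ^ 2"
    by (simp add: algebra_simps power2_eq_square)
  also have "\<dots> = (1 - X) ^ 2 - (fps_const r - 2) * (1 - X) * X + X ^ 2"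
    unfolding XY by (simp add: fps_const_sub[symmetric] numeral_fps_const del: fps_const_sub)
  also have "\<dots> = 1 - fps_const r * X * (1 - X)"
    by (simp add: algebra_simps power2_eq_square)
  finally have main: "\<Phi> * (1 - X) * (1 - fps_const r * X * (1 - X)) =
                        1 - 2 * X - fps_const s * X * (1 - X)"
    by (simp add: Phi)
  have mu: "\<mu> n = fps_nth (\<Phi> * Q ^ n) n" for n
  proof -
    have "\<mu> n = fps_nth (X ^ n * (\<Phi> * Q ^ n)) (2 * n)"
      by (simp add: \<mu>_def central_transform_def \<Phi>_def G_def Y[unfolded Y_def]
          flip: X_def Y_def) (simp add: Y power_mult_distrib mult_ac)
    then show ?thesis
      by (simp add: X_def fps_X_power_mult_nth)
  qed
  have "fps_nth (\<Phi> * ((1 - X) * G)) 0 = 1"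
    using Phi by simp
  then show "\<mu> 0 = 1"
    using \<open>fps_nth G 0 = 1\<close> by (simp add: mu X_def)
  have Qpow: "fps_nth (Q ^ Suc m) k = of_nat ((m + k) choose k)" for m k
    using inverse_one_minus_X_power_nth[of m k, where ?'a = 'a]
    by (simp only: Q_def X_def fps_inverse_power)
  have "\<Phi> * Q ^ Suc n - fps_const r * (X * (\<Phi> * Q ^ n))
          = \<Phi> * (1 - X) * (1 - fps_const r * X * (1 - X)) * Q ^ Suc (Suc n)"
  proof -
    have "\<Phi> * (1 - X) * (1 - fps_const r * X * (1 - X)) * Q ^ Suc (Suc n)
      = \<Phi> * ((1 - X) * Q) * Q ^ Suc n
         - fps_const r * (X * (\<Phi> * Q ^ n * ((1 - X) * Q) * ((1 - X) * Q)))"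
      by (simp add: algebra_simps)
    then show ?thesis
      by (simp add: Q)
  qed
  also have "\<dots> = (1 - 2 * X - fps_const s * X * (1 - X)) * Q ^ Suc (Suc n)"
    by (simp only: main)
  also have "\<dots> = Q ^ Suc (Suc n) - fps_const 2 * (X * Q ^ Suc (Suc n))
                  - fps_const s * (X * (Q ^ Suc n * ((1 - X) * Q)))"
    by (simp add: algebra_simps numeral_fps_const)
  finally have "\<Phi> * Q ^ Suc n - fps_const r * (X * (\<Phi> * Q ^ n)) =
      Q ^ Suc (Suc n) - fps_const 2 * (X * Q ^ Suc (Suc n)) - fps_const s * (X * Q ^ Suc n)"
    by (simp only: Q mult_1_right)
  from arg_cong[OF this, of "\<lambda>f. fps_nth f (Suc n)"]
  have "\<mu> (Suc n) - r * \<mu> n = fps_nth (Q ^ Suc (Suc n)) (Suc n)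
      - 2 * fps_nth (Q ^ Suc (Suc n)) n - s * fps_nth (Q ^ Suc n) n"
    unfolding mu fps_sub_nth fps_mult_left_const_nth
    by (simp only: X_def fps_X_mult_nth diff_Suc_1) simp
  also have "\<dots> = of_nat ((2 * Suc n) choose (Suc n)) - 2 * of_nat (Suc (2 * n) choose n)
                   - s * of_nat ((2 * n) choose n)"
  proof -
    have "Suc n + Suc n = 2 * Suc n" "Suc n + n = Suc (2 * n)" "n + n = 2 * n"
      by simp_all
    then show ?thesis
      by (simp only: Qpow)
  qed
  also have "(2 * Suc n) choose (Suc n) = 2 * (Suc (2 * n) choose n)"
    using binomial_symmetric[of n "Suc (2 * n)"] by (simp add: Suc_diff_le)
  finally show "\<mu> (Suc n) = r * \<mu> n - s * central_binom n"
    by (simp add: central_binom_def algebra_simps)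
qed

theorem theorem1p8:
  fixes r s :: "'a::field_char_0"
  shows "hankel_gf (g_rs r s) =
           (1 - fps_const (s * (r + s - 2)) * fps_X) /
           (1 + fps_const (2 * s * (2 - r)) * fps_X + fps_const (4 * s ^ 2) * fps_X ^ 2) \<and>
         (let h = hankel_det (fps_nth (central_transform (g_rs r s))) in
           h 0 = 1 \<and> h 1 = s * (r - s - 2) \<and>
           (\<forall>n\<ge>2. h n = 2 * s * (r - 2) * h (n - 1) - 4 * s ^ 2 * h (n - 2)))"
proof -
  define h where "h = hankel_det (fps_nth (central_transform (g_rs r s)))"
  note rec = hankel_det_rec[OF central_transform_g_rs_0 central_transform_g_rs_Suc,
      of r s, folded h_def]
  have h_Suc: "h n = 2 * s * (r - 2) * h (n - 1) - 4 * s ^ 2 * h (n - 2)" if "n \<ge> 2" for n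
  proof -
    have "n - 2 + 2 = n" "n - 2 + 1 = n - 1"
      using that by auto
    then show ?thesis
      using rec(3)[of "n - 2"] by (simp only:)
  qed
  define den where
    "den = (1 + fps_const (2 * s * (2 - r)) * fps_X + fps_const (4 * s ^ 2) * fps_X ^ 2 :: 'a fps)"
  have den0: "fps_nth den 0 \<noteq> 0"
    by (simp add: den_def)
  have "Abs_fps h * den = 1 - fps_const (s * (r + s - 2)) * fps_X"
  proof (rule fps_ext)
    fix n
    have "Abs_fps h * den = Abs_fps h + fps_const (2 * s * (2 - r)) * (fps_X * Abs_fps h)
            + fps_const (4 * s ^ 2) * (fps_X ^ 2 * Abs_fps h)"
      by (simp add: den_def algebra_simps)
    then have "fps_nth (Abs_fps h * den) n =
        h n + 2 * s * (2 - r) * (if n = 0 then 0 else h (n - 1))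
            + 4 * s ^ 2 * (if n < 2 then 0 else h (n - 2))"
      by (simp only: fps_add_nth fps_mult_left_const_nth fps_X_mult_nth fps_X_power_mult_nth
          fps_nth_Abs_fps)
    also consider "n = 0" | "n = 1" | "n \<ge> 2"
      by linarith
    then have "h n + 2 * s * (2 - r) * (if n = 0 then 0 else h (n - 1))
            + 4 * s ^ 2 * (if n < 2 then 0 else h (n - 2)) =
        fps_nth (1 - fps_const (s * (r + s - 2)) * fps_X) n"
    proof cases
      case 1
      then show ?thesis using rec(1) by simp
    next
      case 2
      then show ?thesis using rec(1,2) by (simp add: algebra_simps)
    next
      case 3
      then show ?thesis by (subst h_Suc[OF 3]) (simp add: algebra_simps)
    qed
    finally show "fps_nth (Abs_fps h * den) n =
        fps_nth (1 - fps_const (s * (r + s - 2)) * fps_X) n" .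
  qed
  moreover have "Abs_fps h * den / den = Abs_fps h"
    unfolding fps_divide_unit[OF den0] using inverse_mult_eq_1'[OF den0] by (simp add: mult.assoc)
  ultimately have "Abs_fps h = (1 - fps_const (s * (r + s - 2)) * fps_X) / den"
    by simp
  then show ?thesis
    using rec(1,2) h_Suc unfolding hankel_gf_def den_def Let_def h_def[symmetric] by blast
qed

end
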